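(* Let $A\in\mathbb{R}^{n\times n}$ and $B\in\mathbb{R}^{n\times m}$, let $\Omega$ be a bounded set of parameters, and let $\Delta A(p)\in\mathbb{R}^{n\times n}$ for $p\in\Omega$. Let $Q\in\mathbb{R}^{n\times n}$ be symmetric with $Q\ge 0$, let $R_1\in\mathbb{R}^{m\times m}$ and $R_2\in\mathbb{R}^{n\times n}$ be symmetric with $R_1>0$, $R_2>0$, let $F\in\mathbb{R}^{n\times n}$ be symmetric, and let $\alpha,\beta\in\mathbb{R}$. Let $B^{+}$ denote the pseudo-inverse of $B$. Let $\epsilon>0$ be a scalar and let $P\in\mathbb{R}^{n\times n}$ be a symmetric positive definite solution of the Riccati equation $$A^{T}\big\{P^{-1}+BR_{1}^{-1}B^{T}+\alpha^{2}(I-BB^{+})R_{2}^{-1}(I-BB^{+})^{T}\big\}^{-1}A-P+Q+F+\beta^{2}I=0 .$$ Define $$K=-R_{1}^{-1}B^{T}\big\{P^{-1}+BR_{1}^{-1}B^{T}+\alpha^{2}(I-BB^{+})R_{2}^{-1}(I-BB^{+})^{T}\big\}^{-1}A,$$ $$L=-\alpha R_{2}^{-1}(I-BB^{+})\big\{P^{-1}+BR_{1}^{-1}B^{T}+\alpha^{2}(I-BB^{+})R_{2}^{-1}(I-BB^{+})^{T}\big\}^{-1}A,$$ and $A_c=A+BK$. Assume that $\epsilon^{-1}I-P$ is invertible and that the following hold: $$Z:=\epsilon^{-1}I+P(\epsilon^{-1}I-P)^{-1}P>0,$$ $$\Delta A(p)^{T}Z\,\Delta A(p)\le F\quad\text{for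 all }p\in\Omega,$$ $$\beta^{2}I+K^{T}R_{1}K+L^{T}R_{2}L-A_{c}^{T}ZA_{c}\ge 0,$$ where moreover the matrix $Q_1:=\beta^{2}I+K^{T}R_{1}K+L^{T}R_{2}L-A_{c}^{T}ZA_{c}$ is positive definite. Let $\sigma\in(0,1)$ and, with $K^{T}B^{T}ZBK\neq 0$, set $$\mu_{1}=\frac{\sigma\,\lambda_{\min}(Q_{1})}{\lVert K^{T}B^{T}ZBK\rVert}.$$ Then for every $p\in\Omega$ the event-triggered system $$x(k+1)=(A+\Delta A(p))x(k)+BKx(k_i),\qquad k\in[k_i,k_{i+1}),$$ in which the input $u(k_i)=Kx(k_i)$ is updated (i.e. a new event instant occurs) whenever $$\lVert e(k)\rVert^{2}\ge \mu_{1}\lVert x(k)\rVert^{2},\qquad e(k)=x(k_i)-x(k)\ \text{ for } k\in[k_i,k_{i+1}),$$ is input-to-state stable (ISS) with respect to the measurement error $e$.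
   Context: For symmetric matrices, $X\ge 0$ (resp. $X>0$) means positive semidefinite (resp. positive definite), and $X\le Y$ means $Y-X\ge 0$. $I$ is the identity matrix, $\lambda_{\min}$ the smallest eigenvalue of a symmetric matrix, $\lVert\cdot\rVert$ the Euclidean norm of a vector or the induced norm of a matrix. Event-triggered control: time $k$ runs over the non-negative integers; $k_0=0<k_1<k_2<\cdots$ are the event (triggering) instants. The event condition is checked at every $k$. Between events the input is held constant at $u(k_i)=Kx(k_i)$; at the first $k>k_i$ for which $\lVert x(k_i)-x(k)\rVert^2\ge\mu_1\lVert x(k)\rVert^2$, one sets $k_{i+1}=k$ and the input is updated to $Kx(k_{i+1})$ without delay (so the error $e$ is reset to $0$). With the measurement error $e(k)=x(k_i)-x(k)$, $k\in[k_i,k_{i+1})$, the system reads $x(k+1)=(A+\Delta A(p)+BK)x(k)+BKe(k)$. ISS with respect to $e$: there exist a class $KL$ function $\tilde\beta$ and a class $K_\infty$ function $\gamma$ such that, for every initial condition $x(0)$, $\lVert x(k)\rVert\le\tilde\beta(\lVert x(0)\rVert,k)+\gamma\big(\sup_{\tau\in[0,\infty)}\lVert e(\tau)\rVert\big)$ for all $k\ge 0$. *)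

theory Defs
  imports "HOL-Analysis.Analysis"
begin

definition symmetric_mat :: "real^'n^'n \<Rightarrow> bool"
  where "symmetric_mat M \<longleftrightarrow> transpose M = M"

definition pos_semidef :: "real^'n^'n \<Rightarrow> bool"
  where "pos_semidef M \<longleftrightarrow> symmetric_mat M \<and> (\<forall>v. 0 \<le> v \<bullet> (M *v v))"

definition pos_def :: "real^'n^'n \<Rightarrow> bool"
  where "pos_def M \<longleftrightarrow> symmetric_mat M \<and> (\<forall>v. v \<noteq> 0 \<longrightarrow> 0 < v \<bullet> (M *v v))"

definition loewner_le :: "real^'n^'n \<Rightarrow> real^'n^'n \<Rightarrow> bool"  (infix \<open>\<preceq>\<^sub>L\<close> 50)
  where "X \<preceq>\<^sub>L Y \<longleftrightarrow> pos_semidef (Y - X)"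

definition is_eigenvalue :: "real^'n^'n \<Rightarrow> real \<Rightarrow> bool"
  where "is_eigenvalue M l \<longleftrightarrow> (\<exists>v. v \<noteq> 0 \<and> M *v v = l *\<^sub>R v)"

(* Only meaningful for symmetric M, whose real eigenvalues exist. *)
definition lambda_min :: "real^'n^'n \<Rightarrow> real"
  where "lambda_min M = (LEAST l. is_eigenvalue M l)"

definition mat_norm :: "real^'n^'m \<Rightarrow> real"
  where "mat_norm M = onorm (\<lambda>v. M *v v)"

definition is_pseudo_inverse :: "real^'m^'n \<Rightarrow> real^'n^'m \<Rightarrow> bool"
  where "is_pseudo_inverse B X \<longleftrightarrow>
    B ** X ** B = B \<and> X ** B ** X = X \<and> symmetric_mat (B ** X) \<and> symmetric_mat (X ** B)"

(* Moore-Penrose pseudo-inverse: the unique solution of the four Penrose equations. *)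
definition pseudo_inverse :: "real^'m^'n \<Rightarrow> real^'n^'m"
  where "pseudo_inverse B = (THE X. is_pseudo_inverse B X)"

lemma is_pseudo_inverse_unique:
  assumes "is_pseudo_inverse B X" "is_pseudo_inverse B Y"
  shows "X = Y"
proof -
  have X: "B ** X ** B = B" "X ** B ** X = X" "transpose (B ** X) = B ** X" "transpose (X ** B) = X ** B"
   and Y: "B ** Y ** B = B" "Y ** B ** Y = Y" "transpose (B ** Y) = B ** Y" "transpose (Y ** B) = Y ** B"
    using assms by (auto simp: is_pseudo_inverse_def symmetric_mat_def)
  have 1: "B ** X = B ** Y"
  proof -
    have "B ** X = transpose ((B ** Y ** B) ** X)" using X Y by simp
    also have "\<dots> = transpose (B ** X) ** transpose (B ** Y)"
      by (simp add: matrix_transpose_mul matrix_mul_assoc)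
    also have "\<dots> = B ** X ** B ** Y" by (simp add: X Y matrix_mul_assoc)
    finally show ?thesis using X by simp
  qed
  have 2: "X ** B = Y ** B"
  proof -
    have "X ** B = transpose (X ** (B ** Y ** B))" using X Y by simp
    also have "\<dots> = transpose (Y ** B) ** transpose (X ** B)"
      by (simp add: matrix_transpose_mul matrix_mul_assoc)
    also have "\<dots> = Y ** (B ** X ** B)" by (simp only: X(4) Y(4) matrix_mul_assoc)
    finally show ?thesis using X by simp
  qed
  show ?thesis using 1 2 X Y by (metis matrix_mul_assoc)
qed

lemma is_pseudo_inverse_exists:
  fixes B :: "real^'m^'n"
  shows "\<exists>X. is_pseudo_inverse B X"
proof -
  define R where "R = range ((*v) B)"
  define N where "N = {v. B *v v = 0}"
  have sR: "subspace R" unfolding R_def by (rule linear_subspace_image) auto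
  have sN: "subspace N" unfolding N_def subspace_def by (auto simp: matrix_vector_right_distrib matrix_vector_mult_scaleR)
  have ex: "\<exists>u. B *v u - w \<in> {z. \<forall>r\<in>R. z \<bullet> r = 0} \<and> (\<forall>n\<in>N. u \<bullet> n = 0)" for w
  proof -
    obtain y z where yz: "y \<in> span R" "\<And>r. r \<in> span R \<Longrightarrow> orthogonal z r" "w = y + z"
      using orthogonal_subspace_decomp_exists[of R w] by metis
    then obtain v where v: "y = B *v v" using sR by (metis R_def imageE span_eq_iff)
    obtain a u where au: "a \<in> span N" "\<And>n. n \<in> span N \<Longrightarrow> orthogonal u n" "v = a + u"
      using orthogonal_subspace_decomp_exists[of N v] by metis
    have "B *v a = 0" using au(1) sN by (metis (mono_tags, lifting) N_def mem_Collect_eq span_eq_iff)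
    then have "B *v u = y" using v au by (simp add: matrix_vector_right_distrib)
    then show ?thesis using yz au by (intro exI[of _ u]) (auto simp: orthogonal_def span_base inner_diff_left)
  qed
  then obtain f where f1: "\<And>w r. r \<in> R \<Longrightarrow> (B *v f w - w) \<bullet> r = 0" and f2: "\<And>w n. n \<in> N \<Longrightarrow> f w \<bullet> n = 0"
    by (auto simp: Bex_def choice_iff) metis
  have uniq: "u = u'" if "\<And>r. r \<in> R \<Longrightarrow> (B *v u - w) \<bullet> r = 0" "\<And>r. r \<in> R \<Longrightarrow> (B *v u' - w) \<bullet> r = 0"
     "\<And>n. n \<in> N \<Longrightarrow> u \<bullet> n = 0" "\<And>n. n \<in> N \<Longrightarrow> u' \<bullet> n = 0" for u u' w
  proof -
    have r: "B *v (u - u') \<in> R" by (auto simp: R_def)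
    have "B *v (u - u') = (B *v u - w) - (B *v u' - w)" by (simp add: matrix_vector_mult_diff_distrib)
    then have "(B *v (u - u')) \<bullet> (B *v (u - u')) = 0" using that(1)[OF r] that(2)[OF r]
      by (metis inner_diff_left diff_zero)
    then have n: "u - u' \<in> N" by (auto simp: N_def)
    have "(u - u') \<bullet> (u - u') = 0" using that(3)[OF n] that(4)[OF n] by (simp add: inner_diff_left)
    then show ?thesis by simp
  qed
  have lin: "linear f"
  proof (rule linearI)
    fix a b :: "real^'n"
    show "f (a + b) = f a + f b"
    proof (rule uniq[of _ "a+b"])
      fix r assume "r \<in> R"
      then show "(B *v f (a + b) - (a + b)) \<bullet> r = 0" by (rule f1)
      have "B *v (f a + f b) - (a + b) = (B *v f a - a) + (B *v f b - b)" by (simp add: matrix_vector_right_distrib)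
      then show "(B *v (f a + f b) - (a + b)) \<bullet> r = 0" using f1[OF \<open>r \<in> R\<close>] by (metis inner_add_left add_0)
    qed (auto simp: f2 inner_add_left)
  next
    fix c :: real and a :: "real^'n"
    show "f (c *\<^sub>R a) = c *\<^sub>R f a"
    proof (rule uniq[of _ "c *\<^sub>R a"])
      fix r assume "r \<in> R"
      then show "(B *v f (c *\<^sub>R a) - c *\<^sub>R a) \<bullet> r = 0" by (rule f1)
      have "B *v (c *\<^sub>R f a) - c *\<^sub>R a = c *\<^sub>R (B *v f a - a)" by (simp add: matrix_vector_mult_scaleR scaleR_right_diff_distrib)
      then show "(B *v (c *\<^sub>R f a) - c *\<^sub>R a) \<bullet> r = 0" using f1[OF \<open>r \<in> R\<close>] by simp
    qed (auto simp: f2)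
  qed
  have BfB: "B *v f (B *v v) = B *v v" for v
  proof -
    have "B *v f (B *v v) - B *v v \<in> R" by (auto simp: R_def matrix_vector_mult_diff_distrib[symmetric])
    from f1[OF this, of "B *v v"] show ?thesis by simp
  qed
  have fBf: "f (B *v f w) = f w" for w
    by (rule uniq[of _ "B *v f w"]) (auto simp: f1 f2)
  have sym1: "(B *v f a) \<bullet> b = a \<bullet> (B *v f b)" for a b
    using f1[of "B *v f b" a] f1[of "B *v f a" b] by (auto simp: R_def inner_diff_left inner_diff_right inner_commute)
  have kn: "f (B *v a) - a \<in> N" for a by (auto simp: N_def matrix_vector_mult_diff_distrib BfB)
  have sym2: "f (B *v a) \<bullet> b = a \<bullet> f (B *v b)" for a b
    using f2[OF kn[of b], of "B *v a"] f2[OF kn[of a], of "B *v b"] by (auto simp: inner_diff_right inner_commute)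
  have symI: "symmetric_mat M" if "\<And>a b. (M *v a) \<bullet> b = a \<bullet> (M *v b)" for M :: "real^'k^'k"
    unfolding symmetric_mat_def matrix_eq
  proof
    fix x
    have "(transpose M *v x) \<bullet> b = (M *v x) \<bullet> b" for b
      by (metis that dot_lmul_matrix inner_commute transpose_matrix_vector)
    then show "transpose M *v x = M *v x" by (meson vector_eq_rdot)
  qed
  define X where "X = matrix f"
  have Xv: "X *v w = f w" for w unfolding X_def using lin by (simp add: matrix_works)
  have "is_pseudo_inverse B X" unfolding is_pseudo_inverse_def
    by (intro conjI symI) (auto simp: matrix_eq matrix_vector_mul_assoc[symmetric] Xv BfB fBf sym1 sym2)
  then show ?thesis ..
qed

lemma is_pseudo_inverse_pseudo_inverse: "is_pseudo_inverse B (pseudo_inverse B)"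
  unfolding pseudo_inverse_def
  by (rule theI') (use is_pseudo_inverse_exists is_pseudo_inverse_unique in blast)

definition class_K :: "(real \<Rightarrow> real) \<Rightarrow> bool"
  where "class_K \<gamma> \<longleftrightarrow> continuous_on {0..} \<gamma> \<and> strict_mono_on {0..} \<gamma> \<and> \<gamma> 0 = 0"

definition class_Kinf :: "(real \<Rightarrow> real) \<Rightarrow> bool"
  where "class_Kinf \<gamma> \<longleftrightarrow> class_K \<gamma> \<and> filterlim \<gamma> at_top at_top"

definition class_KL :: "(real \<Rightarrow> real \<Rightarrow> real) \<Rightarrow> bool"
  where "class_KL \<beta> \<longleftrightarrow>
    (\<forall>t\<ge>0. class_K (\<lambda>r. \<beta> r t)) \<and>
    (\<forall>r\<ge>0. antimono_on {0..} (\<beta> r) \<and> (\<beta> r \<longlongrightarrow> 0) at_top)"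

(* A system is given by its set of admissible pairs (state x, error signal e).
   If e is unbounded, the supremum in the ISS estimate is infinite and the estimate is
   void; as the real-valued SUP is meaningless then, that case is excluded explicitly. *)
definition input_to_state_stable ::
    "((nat \<Rightarrow> 'a::real_normed_vector) \<times> (nat \<Rightarrow> 'b::real_normed_vector)) set \<Rightarrow> bool"
  where "input_to_state_stable S \<longleftrightarrow>
    (\<exists>\<beta> \<gamma>. class_KL \<beta> \<and> class_Kinf \<gamma> \<and>
      (\<forall>(x, e)\<in>S. bounded (range e) \<longrightarrow>
        (\<forall>k. norm (x k) \<le> \<beta> (norm (x 0)) (real k) + \<gamma> (SUP \<tau>. norm (e \<tau>)))))"

(* T is the set {k_0 = 0 < k_1 < k_2 < ...} of event instants, which may be finite.
   The first condition for s in T says that the next element of T after s, if there is one,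
   is the first k > s at which the event condition holds; in the second one, s = k_i
   and k ranges over [k_i, k_{i+1}). *)
definition event_triggered_run ::
    "real^'n^'n \<Rightarrow> real^'m^'n \<Rightarrow> real^'n^'m \<Rightarrow> real
      \<Rightarrow> nat set \<Rightarrow> (nat \<Rightarrow> real^'n) \<Rightarrow> (nat \<Rightarrow> real^'n) \<Rightarrow> bool"
  where "event_triggered_run A B K \<mu> T x e \<longleftrightarrow>
    0 \<in> T \<and>
    (\<forall>s\<in>T. \<forall>k>s. T \<inter> {s<..<k} = {} \<longrightarrow>
      (k \<in> T \<longleftrightarrow> (norm (x s - x k))\<^sup>2 \<ge> \<mu> * (norm (x k))\<^sup>2)) \<and>
    (\<forall>s\<in>T. \<forall>k\<ge>s. T \<inter> {s<..k} = {} \<longrightarrow>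
      e k = x s - x k \<and> x (Suc k) = A *v x k + B *v (K *v x s))"

lemma event_triggered_run_exists:
  "\<exists>T x e. x 0 = x0 \<and> event_triggered_run A B K \<mu> T x e"
proof -
  define st where "st = rec_nat (x0, x0, True) (\<lambda>k (x, h, f). let x' = A *v x + B *v (K *v h) in
     if (norm (h - x'))\<^sup>2 \<ge> \<mu> * (norm x')\<^sup>2 then (x', x', True) else (x', h, False))"
  define x where "x k = fst (st k)" for k
  define h where "h k = fst (snd (st k))" for k
  define f where "f k = snd (snd (st k))" for k
  have 0: "x 0 = x0" "h 0 = x0" "f 0" by (auto simp: x_def h_def f_def st_def)
  have S: "x (Suc k) = A *v x k + B *v (K *v h k)"
     "f (Suc k) \<longleftrightarrow> (norm (h k - x (Suc k)))\<^sup>2 \<ge> \<mu> * (norm (x (Suc k)))\<^sup>2"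
     "h (Suc k) = (if f (Suc k) then x (Suc k) else h k)" for k
    by (auto simp: x_def h_def f_def st_def Let_def split: prod.splits)
  have fx: "h k = x k" if "f k" for k using that 0 S(3) by (cases k) auto
  have H: "h k = x s" if "f s" "s \<le> k" "Collect f \<inter> {s<..k} = {}" for s k
    using that(2,3)
  proof (induction k rule: dec_induct)
    case base then show ?case using fx that by simp
  next
    case (step k)
    then have "\<not> f (Suc k)" by auto
    moreover have "Collect f \<inter> {s<..k} = {}" using step by auto
    ultimately show ?case using step S(3) by simp
  qed
  have "event_triggered_run A B K \<mu> (Collect f) x (\<lambda>k. h k - x k)"
    unfolding event_triggered_run_def
  proof (intro conjI ballI allI impI)
    fix s k assume "s \<in> Collect f" "s < k" "Collect f \<inter> {s<..<k} = {}"
    moreover then obtain j where "k = Suc j" by (cases k) auto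
    moreover from this have "{s<..<k} = {s<..j}" by auto
    ultimately show "(k \<in> Collect f) = (\<mu> * (norm (x k))\<^sup>2 \<le> (norm (x s - x k))\<^sup>2)"
      using H[of s j] S(2)[of j] by auto
  qed (use H S 0 in auto)
  then show ?thesis using 0 by blast
qed

definition event_triggered_system ::
    "real^'n^'n \<Rightarrow> real^'m^'n \<Rightarrow> real^'n^'m \<Rightarrow> real
      \<Rightarrow> ((nat \<Rightarrow> real^'n) \<times> (nat \<Rightarrow> real^'n)) set"
  where "event_triggered_system A B K \<mu> = {(x, e). \<exists>T. event_triggered_run A B K \<mu> T x e}"

end

theory Submission
  imports Defs
begin

text \<open>
  Put \<open>V x = x \<bullet> P x\<close> and \<open>G = A + \<Delta>A + B K\<close>. Positivity of \<open>Z\<close> forces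
  \<open>inverse \<epsilon> I - P > 0\<close>, since an eigenvector of \<open>P\<close> with eigenvalue \<open>l > inverse \<epsilon> = c\<close> would give
  \<open>Z\<close> the eigenvalue \<open>(c\<^sup>2 - c l + l\<^sup>2) / (c - l) < 0\<close>. Completing the square then bounds
  \<open>V (A\<^sub>c x + \<Delta>A x)\<close> by the sum of the \<open>Z\<close>-forms of \<open>A\<^sub>c x\<close> and \<open>\<Delta>A x\<close>, and the Riccati equation
  turns this into \<open>V (G x) \<le> V x - x \<bullet> Q\<^sub>1 x\<close>. So \<open>V\<close> is a quadratic Lyapunov function of the
  unperturbed loop, and \<open>x(k+1) = G x(k) + B K e(k)\<close> is ISS for an arbitrary signal \<open>e\<close>.
\<close>

section \<open>Symmetric matrices, inverses and positive definite quadratic forms\<close>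

lemma inner_transpose_mult:
  fixes A :: "real^'n^'m"
  shows "x \<bullet> (transpose A *v y) = (A *v x) \<bullet> y"
  by (metis dot_lmul_matrix inner_commute transpose_matrix_vector)

lemma symmetric_mat_inner:
  assumes "symmetric_mat M"
  shows "x \<bullet> (M *v y) = (M *v x) \<bullet> y"
  using assms inner_transpose_mult[of x M y] by (simp add: symmetric_mat_def)

lemma matrix_vector_mult_uminus_left: "(- A) *v x = - (A *v (x :: real^'n))"
  by (metis add.inverse_inverse matrix_vector_mult_diff_rdistrib diff_0 matrix_vector_mult_0)

lemma matrix_inv_cancel_vec:
  fixes M :: "real^'n^'n"
  assumes "invertible M"
  shows "M *v (matrix_inv M *v y) = y" "matrix_inv M *v (M *v y) = y"
proof -
  have "M ** matrix_inv M = mat 1 \<and> matrix_inv M ** M = mat 1"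
    using assms unfolding invertible_def matrix_inv_def by (rule someI_ex)
  then show "M *v (matrix_inv M *v y) = y" "matrix_inv M *v (M *v y) = y"
    by (simp_all add: matrix_vector_mul_assoc)
qed

lemma pos_def_invertible:
  assumes "pos_def M"
  shows "invertible M"
proof -
  have "\<And>v. M *v v = 0 \<Longrightarrow> v = 0"
    using assms unfolding pos_def_def by (metis inner_zero_right less_irrefl)
  then show ?thesis
    using matrix_left_invertible_ker[of M] invertible_left_inverse[of M] by blast
qed

lemma pos_def_nonneg:
  assumes "pos_def M"
  shows "0 \<le> v \<bullet> (M *v v)"
  using assms unfolding pos_def_def by (cases "v = 0") (auto intro: less_imp_le)

lemma pos_def_inv_pos:
  assumes "pos_def M" "y \<noteq> 0"
  shows "0 < y \<bullet> (matrix_inv M *v y)"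
proof -
  let ?z = "matrix_inv M *v y"
  have y: "M *v ?z = y"
    using assms pos_def_invertible matrix_inv_cancel_vec(1) by blast
  with assms(2) have "?z \<noteq> 0" by auto
  then have "0 < ?z \<bullet> (M *v ?z)"
    using assms(1) by (simp add: pos_def_def)
  then show ?thesis by (simp add: y inner_commute)
qed

text \<open>Compactness of the unit sphere yields a minimiser \<open>v\<close> of the quadratic
  form, and scaling turns its value \<open>l\<close> into a lower bound everywhere. The residual
  \<open>u = M *v v - l *\<^sub>R v\<close> vanishes because otherwise a small step from
  \<open>v\<close> against \<open>u\<close> would violate that bound.\<close>

lemma symmetric_mat_Rayleigh_min:
  fixes M :: "real^'n^'n"
  assumes "symmetric_mat M"
  obtains v l where "v \<noteq> 0" "M *v v = l *\<^sub>R v" "\<And>w. l * (norm w)\<^sup>2 \<le> w \<bullet> (M *v w)"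
proof -
  let ?f = "\<lambda>v. v \<bullet> (M *v v)"
  have "sphere (0::real^'n) 1 \<noteq> {}" by simp
  moreover have "continuous_on (sphere 0 1) ?f"
    by (intro continuous_on_inner continuous_on_id linear_continuous_on matrix_vector_mul_bounded_linear)
  ultimately obtain v where v: "v \<in> sphere 0 1" and min: "\<And>w. w \<in> sphere 0 1 \<Longrightarrow> ?f v \<le> ?f w"
    using continuous_attains_inf[OF compact_sphere] by blast
  define l where "l = ?f v"
  have low: "l * (norm w)\<^sup>2 \<le> ?f w" for w
  proof (cases "w = 0")
    case False
    have "l \<le> ?f (inverse (norm w) *\<^sub>R w)"
      unfolding l_def by (rule min) (use False in simp)
    also have "\<dots> = ?f w / (norm w)\<^sup>2"
      by (simp add: matrix_vector_mult_scaleR power2_eq_square divide_inverse)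
    finally show ?thesis using False by (simp add: field_simps)
  qed simp
  define u where "u = M *v v - l *\<^sub>R v"
  have fv: "?f v = l" "norm v = 1" using v by (auto simp: l_def)
  have Mu: "v \<bullet> (M *v u) = u \<bullet> (M *v v)"
    using symmetric_mat_inner[OF assms, of v u] by (simp add: inner_commute)
  \<comment> \<open>First-order optimality: a quadratic in \<open>t\<close> that is nonnegative and vanishes at \<open>0\<close>
      has no linear term; here the linear coefficient is \<open>2 * (u \<bullet> u)\<close>.\<close>
  define c where "c = ?f u - l * (norm u)\<^sup>2"
  have quad: "0 \<le> 2 * t * (u \<bullet> u) + t\<^sup>2 * c" for t
  proof -
    have "?f (v + t *\<^sub>R u) = l + 2 * t * (u \<bullet> (M *v v)) + t\<^sup>2 * ?f u"
      using fv Mu by (simp add: matrix_vector_right_distrib matrix_vector_mult_scaleR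
          inner_add_left inner_add_right power2_eq_square algebra_simps)
    moreover have "(norm (v + t *\<^sub>R u))\<^sup>2 = 1 + 2 * t * (u \<bullet> v) + t\<^sup>2 * (norm u)\<^sup>2"
      unfolding power2_norm_eq_inner
      using fv by (simp add: norm_eq_1 inner_add_left inner_add_right inner_commute
          power2_eq_square algebra_simps)
    ultimately have "0 \<le> 2 * t * (u \<bullet> (M *v v) - l * (u \<bullet> v)) + t\<^sup>2 * c"
      using low[of "v + t *\<^sub>R u"] by (simp add: c_def algebra_simps)
    moreover have "u \<bullet> (M *v v) - l * (u \<bullet> v) = u \<bullet> u"
      by (simp add: u_def inner_diff_right)
    ultimately show ?thesis by simp
  qed
  have "u \<bullet> u = 0"
  proof (rule ccontr)
    assume "u \<bullet> u \<noteq> 0"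
    then have pos: "0 < u \<bullet> u" by simp
    \<comment> \<open>A negative step, short enough that
      \<open>\<bar>t * c\<bar> \<le> u \<bullet> u\<close>: the linear term then dominates the
      quadratic one and the expression in \<open>quad\<close> becomes negative.\<close>
    define t where "t = - (u \<bullet> u) / (\<bar>c\<bar> + 1)"
    have t: "t < 0" using pos by (simp add: t_def divide_neg_pos)
    have "t * c \<ge> - (u \<bullet> u)"
    proof -
      have "\<bar>t * c\<bar> = (u \<bullet> u) * (\<bar>c\<bar> / (\<bar>c\<bar> + 1))"
        by (simp add: t_def abs_mult abs_divide)
      also have "\<dots> \<le> (u \<bullet> u) * 1"
        using pos by (intro mult_left_mono) auto
      finally show ?thesis by linarith
    qed
    then have "0 < 2 * (u \<bullet> u) + t * c" using pos by linarith
    then have "t * (2 * (u \<bullet> u) + t * c) < 0" using t by (simp add: mult_neg_pos)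
    then show False using quad[of t] by (simp add: power2_eq_square algebra_simps)
  qed
  then have "M *v v = l *\<^sub>R v" by (simp add: u_def)
  moreover have "v \<noteq> 0" using fv(2) by auto
  ultimately show thesis using that low by blast
qed

text \<open>The Rayleigh minimum serves as \<open>m\<close>; it is positive because the form is
  positive at the eigenvector attaining it.\<close>

lemma pos_def_lower_bound:
  assumes "pos_def M"
  obtains m where "0 < m" "\<And>v. m * (norm v)\<^sup>2 \<le> v \<bullet> (M *v v)"
proof -
  obtain v l where v: "v \<noteq> 0" "M *v v = l *\<^sub>R v" "\<And>w. l * (norm w)\<^sup>2 \<le> w \<bullet> (M *v w)"
    using symmetric_mat_Rayleigh_min assms unfolding pos_def_def by metis
  have "0 < v \<bullet> (M *v v)" using assms v(1) by (simp add: pos_def_def)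
  then have "0 < l * (v \<bullet> v)" using v(2) by simp
  then have "0 < l" by (rule zero_less_mult_pos2) (simp add: v(1))
  then show thesis using that v(3) by blast
qed

lemma quad_form_upper_bound:
  fixes M :: "real^'n^'n"
  obtains C where "0 < C" "\<And>v. v \<bullet> (M *v v) \<le> C * (norm v)\<^sup>2"
proof -
  obtain C where C: "0 < C" "\<And>v. norm (M *v v) \<le> norm v * C"
    using bounded_linear.pos_bounded[OF matrix_vector_mul_bounded_linear[of M]] by metis
  have "v \<bullet> (M *v v) \<le> C * (norm v)\<^sup>2" for v
  proof -
    have "v \<bullet> (M *v v) \<le> norm v * norm (M *v v)" by (rule norm_cauchy_schwarz)
    also have "\<dots> \<le> norm v * (norm v * C)" by (intro mult_left_mono C) simp
    finally show ?thesis by (simp add: power2_eq_square algebra_simps)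
  qed
  then show thesis using that C by blast
qed

text \<open>Expanding the nonnegative form at \<open>d *\<^sub>R a - b\<close> and dividing by
  \<open>d\<close> bounds the cross term. The free parameter \<open>d\<close> trades growth in
  \<open>a\<close> against growth in \<open>b\<close>.\<close>

lemma quad_form_Young:
  assumes "pos_def P" "0 < d"
  shows "(a + b) \<bullet> (P *v (a + b)) \<le> (1 + d) * (a \<bullet> (P *v a)) + (1 + 1 / d) * (b \<bullet> (P *v b))"
proof -
  have sym: "a \<bullet> (P *v b) = b \<bullet> (P *v a)"
    using assms symmetric_mat_inner[of P a b] by (simp add: pos_def_def inner_commute)
  have "0 \<le> (d *\<^sub>R a - b) \<bullet> (P *v (d *\<^sub>R a - b))"
    using assms by (intro pos_def_nonneg)
  also have "\<dots> = d * (d * (a \<bullet> (P *v a)) - 2 * (b \<bullet> (P *v a)) + (1 / d) * (b \<bullet> (P *v b)))"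
    using assms(2) sym by (simp add: matrix_vector_mult_diff_distrib matrix_vector_mult_scaleR
        inner_diff_left inner_diff_right field_simps)
  finally have "0 \<le> d * (a \<bullet> (P *v a)) - 2 * (b \<bullet> (P *v a)) + (1 / d) * (b \<bullet> (P *v b))"
    using assms(2) by (simp add: zero_le_mult_iff)
  then show ?thesis
    using sym by (simp add: matrix_vector_right_distrib inner_add_left inner_add_right algebra_simps)
qed

section \<open>Comparison functions and ISS from a quadratic Lyapunov function\<close>

lemma class_KL_exponential:
  assumes "0 < c" "0 < r" "r < 1"
  shows "class_KL (\<lambda>s t. c * r powr t * s)"
  unfolding class_KL_def class_K_def
proof (intro conjI allI impI)
  fix t :: real
  show "continuous_on {0..} (\<lambda>s. c * r powr t * s)" by (intro continuous_intros)
  show "strict_mono_on {0..} (\<lambda>s. c * r powr t * s)"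
    using assms by (auto intro!: strict_mono_onI mult_strict_left_mono)
  show "c * r powr t * 0 = 0" by simp
next
  fix s :: real assume "0 \<le> s"
  then show "antimono_on {0..} (\<lambda>t. c * r powr t * s)"
    using assms by (auto intro!: monotone_onI mult_right_mono mult_left_mono powr_mono')
  have "((\<lambda>t. exp (ln r * t)) \<longlongrightarrow> 0) at_top"
    using assms by (intro filterlim_compose[OF exp_at_bot] filterlim_tendsto_neg_mult_at_bot[OF tendsto_const] filterlim_ident) auto
  then have "((\<lambda>t. r powr t) \<longlongrightarrow> 0) at_top"
    using assms by (simp add: powr_def mult.commute)
  then have "((\<lambda>t. c * r powr t * s) \<longlongrightarrow> c * 0 * s) at_top"
    by (intro tendsto_intros)
  then show "((\<lambda>t. c * r powr t * s) \<longlongrightarrow> 0) at_top" by simp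
qed

lemma class_Kinf_linear:
  assumes "0 < c"
  shows "class_Kinf (\<lambda>s. c * s)"
  unfolding class_Kinf_def class_K_def
  using assms by (auto intro!: continuous_intros strict_mono_onI filterlim_tendsto_pos_mult_at_top[OF tendsto_const] filterlim_ident)

text \<open>The constant \<open>b / (1 - r)\<close> is the fixed point of the map taking
  \<open>v\<close> to \<open>r * v + b\<close>, so it reproduces itself in the induction
  step.\<close>

lemma affine_recursion_bound:
  fixes V :: "nat \<Rightarrow> real"
  assumes "0 \<le> r" "r < 1" "0 \<le> b" "\<And>k. V (Suc k) \<le> r * V k + b"
  shows "V k \<le> r ^ k * V 0 + b / (1 - r)"
proof (induction k)
  case 0
  then show ?case using assms by simp
next
  case (Suc k)
  have "V (Suc k) \<le> r * (r ^ k * V 0 + b / (1 - r)) + b"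
    using assms(4)[of k] mult_left_mono[OF Suc assms(1)] by linarith
  also have "\<dots> = r ^ Suc k * V 0 + b / (1 - r)"
    using assms(2) by (simp add: field_simps)
  finally show ?case .
qed

text \<open>The form of \<open>P\<close> contracts by \<open>1 - d\<close> under \<open>G\<close>,
  and Young's inequality with the same \<open>d\<close> costs a factor \<open>1 + d\<close> to split
  off the input. The product \<open>1 - d\<^sup>2\<close> is still below 1, so the form obeys an
  affine recursion; taking square roots gives an exponential KL bound and a linear gain.\<close>

lemma Lyapunov_imp_input_to_state_stable:
  fixes P Q G :: "real^'n^'n" and H :: "real^'m^'n"
  assumes P: "pos_def P" and Q: "pos_def Q"
    and decrease: "\<And>v. (G *v v) \<bullet> (P *v (G *v v)) \<le> v \<bullet> (P *v v) - v \<bullet> (Q *v v)"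
    and S: "\<And>x e k. (x, e) \<in> S \<Longrightarrow> x (Suc k) = G *v x k + H *v e k"
  shows "input_to_state_stable S"
proof -
  let ?V = "\<lambda>v. v \<bullet> (P *v v)"
  obtain m where m: "0 < m" "\<And>v. m * (norm v)\<^sup>2 \<le> ?V v"
    using pos_def_lower_bound[OF P] by blast
  obtain q where q: "0 < q" "\<And>v. q * (norm v)\<^sup>2 \<le> v \<bullet> (Q *v v)"
    using pos_def_lower_bound[OF Q] by blast
  obtain C0 where C0: "0 < C0" "\<And>v. ?V v \<le> C0 * (norm v)\<^sup>2"
    using quad_form_upper_bound[of P] by blast
  \<comment> \<open>Adding \<open>q\<close> to the upper constant forces \<open>q < C\<close>, so
    that \<open>d = q / C\<close> lies strictly between 0 and 1 and the rate \<open>r\<close> is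
    positive.\<close>
  define C where "C = C0 + q"
  have C: "0 < C" "q < C" using C0(1) q(1) by (auto simp: C_def)
  have C_upper: "?V v \<le> C * (norm v)\<^sup>2" for v
  proof -
    have "0 \<le> q * (norm v)\<^sup>2" using q(1) by simp
    then show ?thesis using C0(2)[of v] unfolding C_def distrib_right by linarith
  qed
  obtain h where h: "0 < h" "\<And>v. norm (H *v v) \<le> norm v * h"
    using bounded_linear.pos_bounded[OF matrix_vector_mul_bounded_linear[of H]] by metis
  define d where "d = q / C"
  have d: "0 < d" "d < 1" using q(1) C by (auto simp: d_def)
  define r where "r = 1 - d\<^sup>2"
  have r: "0 < r" "r < 1" using d by (auto simp: r_def power_less_one_iff)
  \<comment> \<open>The decrease is at least \<open>q * (norm v)\<^sup>2\<close>, which by the upper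
    bound on the form is at least the fraction \<open>d\<close> of its current value.\<close>
  have contract: "?V (G *v v) \<le> (1 - d) * ?V v" for v
  proof -
    have "d * ?V v \<le> d * (C * (norm v)\<^sup>2)" using C_upper d by (intro mult_left_mono) auto
    also have "\<dots> = q * (norm v)\<^sup>2" using C by (simp add: d_def)
    finally show ?thesis using q(2)[of v] decrease[of v] by (simp add: algebra_simps)
  qed
  \<comment> \<open>The limit value of the affine recursion, divided by \<open>m\<close> to pass
    from the form back to the squared norm, with the factor \<open>s\<^sup>2\<close> taken
    out.\<close>
  define D where "D = (1 + 1 / d) * C * h\<^sup>2 / ((1 - r) * m)"
  have D: "0 < D" using d C h r m by (auto simp: D_def intro!: divide_pos_pos mult_pos_pos add_pos_pos)
  have bound: "norm (x k) \<le> sqrt (C / m) * sqrt r powr real k * norm (x 0) + sqrt D * (SUP \<tau>. norm (e \<tau>))"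
    if xe: "(x, e) \<in> S" and bd: "bounded (range e)" for x e k
  proof -
    define s where "s = (SUP \<tau>. norm (e \<tau>))"
    \<comment> \<open>Boundedness of \<open>e\<close> makes the real-valued supremum a genuine upper
      bound for every \<open>norm (e j)\<close>.\<close>
    have "bdd_above (range (\<lambda>\<tau>. norm (e \<tau>)))"
      using bd unfolding bounded_iff bdd_above_def by auto
    then have es: "norm (e j) \<le> s" for j unfolding s_def by (rule cSUP_upper[rotated]) simp
    then have s: "0 \<le> s" using norm_ge_zero order_trans by blast
    have step: "?V (x (Suc j)) \<le> r * ?V (x j) + (1 + 1 / d) * (C * (h * s)\<^sup>2)" for j
    proof -
      have "norm (H *v e j) \<le> h * s"
        using h(2)[of "e j"] mult_right_mono[OF es[of j], of h] h(1) unfolding mult.commute[of h s]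
        by linarith
      then have "(norm (H *v e j))\<^sup>2 \<le> (h * s)\<^sup>2" by (intro power_mono) auto
      then have "?V (H *v e j) \<le> C * (h * s)\<^sup>2"
        using C(1) C_upper[of "H *v e j"] by (meson mult_left_mono order_trans less_imp_le)
      then have "(1 + 1 / d) * ?V (H *v e j) \<le> (1 + 1 / d) * (C * (h * s)\<^sup>2)"
        using d by (intro mult_left_mono) auto
      moreover have "(1 + d) * ?V (G *v x j) \<le> (1 + d) * ((1 - d) * ?V (x j))"
        using d contract by (intro mult_left_mono) auto
      moreover have "(1 + d) * ((1 - d) * ?V (x j)) = r * ?V (x j)"
        by (simp add: r_def power2_eq_square algebra_simps)
      ultimately show ?thesis
        using quad_form_Young[OF P d(1), of "G *v x j" "H *v e j"] S[OF xe, of j] by simp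
    qed
    have "m * (norm (x k))\<^sup>2 \<le> r ^ k * ?V (x 0) + (1 + 1 / d) * (C * (h * s)\<^sup>2) / (1 - r)"
      using affine_recursion_bound[of r _ "\<lambda>j. ?V (x j)", OF _ _ _ step] r d C m(2)[of "x k"]
      by (smt (verit) divide_nonneg_nonneg mult_nonneg_nonneg zero_le_power2)
    also have "\<dots> \<le> r ^ k * (C * (norm (x 0))\<^sup>2) + (1 + 1 / d) * (C * (h * s)\<^sup>2) / (1 - r)"
      using C_upper r by (intro add_right_mono mult_left_mono) auto
    also have "\<dots> = m * (C / m * r ^ k * (norm (x 0))\<^sup>2 + D * s\<^sup>2)"
      using m r by (simp add: D_def field_simps)
    finally have "(norm (x k))\<^sup>2 \<le> C / m * r ^ k * (norm (x 0))\<^sup>2 + D * s\<^sup>2"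
      using m(1) by simp
    then have "norm (x k) \<le> sqrt (C / m * r ^ k * (norm (x 0))\<^sup>2 + D * s\<^sup>2)"
      using real_le_rsqrt by blast
    \<comment> \<open>Subadditivity of the square root separates the transient from the gain; the
      decay rate of the norm becomes \<open>sqrt r\<close>.\<close>
    also have "\<dots> \<le> sqrt (C / m * r ^ k * (norm (x 0))\<^sup>2) + sqrt (D * s\<^sup>2)"
      using C m r D by (intro sqrt_add_le_add_sqrt) auto
    also have "\<dots> = sqrt (C / m) * sqrt r powr real k * norm (x 0) + sqrt D * s"
      using r s by (simp add: real_sqrt_mult real_sqrt_divide real_sqrt_power powr_realpow)
    finally show ?thesis unfolding s_def .
  qed
  show ?thesis
    unfolding input_to_state_stable_def
  proof (intro exI conjI)
    show "class_KL (\<lambda>s t. sqrt (C / m) * sqrt r powr t * s)"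
      using C m r by (intro class_KL_exponential) auto
    show "class_Kinf (\<lambda>s. sqrt D * s)" using D by (intro class_Kinf_linear) auto
  qed (use bound in auto)
qed

text \<open>The input applied at time \<open>k\<close> was sampled at the last event instant
  \<open>s\<close> up to \<open>k\<close>, which exists because \<open>0 \<in> T\<close>.
  Substituting \<open>x s = x k + e k\<close> turns the held input into state feedback plus an error
  input.\<close>

lemma event_triggered_run_error_form:
  assumes "event_triggered_run A B K \<mu> T x e"
  shows "x (Suc k) = (A + B ** K) *v x k + (B ** K) *v e k"
proof -
  define s where "s = Max (T \<inter> {..k})"
  have ne: "T \<inter> {..k} \<noteq> {}" using assms by (auto simp: event_triggered_run_def)
  have "s \<in> T \<inter> {..k}" unfolding s_def using ne by (intro Max_in) auto
  moreover have "T \<inter> {s<..k} = {}"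
  proof -
    have "j \<le> s" if "j \<in> T" "j \<le> k" for j unfolding s_def using that by (intro Max_ge) auto
    then show ?thesis by force
  qed
  ultimately have "e k = x s - x k" "x (Suc k) = A *v x k + B *v (K *v x s)"
    using assms unfolding event_triggered_run_def by auto
  then show ?thesis
    by (simp add: matrix_vector_mul_assoc matrix_vector_mult_add_rdistrib matrix_vector_mult_diff_distrib)
qed

section \<open>Splitting the form of \<open>P\<close> by means of \<open>Z\<close>\<close>

text \<open>It suffices that the least eigenvalue \<open>l\<close> of the gap is positive. Its
  eigenvector belongs to \<open>P\<close> with eigenvalue \<open>c - l\<close>, hence to the matrix
  assumed positive definite with eigenvalue \<open>c + (c - l)\<^sup>2 / l\<close>; invertibility of
  the gap excludes \<open>l = 0\<close>.\<close>

lemma pos_def_gap_of_pos_def_Z: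
  fixes P :: "real^'n^'n"
  assumes P: "pos_def P" and c: "0 < c" and inv: "invertible (c *\<^sub>R mat 1 - P)"
    and Z: "pos_def (c *\<^sub>R mat 1 + P ** matrix_inv (c *\<^sub>R mat 1 - P) ** P)"
  shows "pos_def (c *\<^sub>R mat 1 - P)"
proof -
  let ?N = "c *\<^sub>R mat 1 - P"
  have Nv: "?N *v v = c *\<^sub>R v - P *v v" for v
    by (simp add: matrix_vector_mult_diff_rdistrib scaleR_matrix_vector_assoc[symmetric])
  have sN: "symmetric_mat ?N"
    using P by (simp add: pos_def_def symmetric_mat_def transpose_def vec_eq_iff mat_def)
  obtain v l where v: "v \<noteq> 0" "?N *v v = l *\<^sub>R v" and low: "\<And>w. l * (norm w)\<^sup>2 \<le> w \<bullet> (?N *v w)"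
    using symmetric_mat_Rayleigh_min[OF sN] by blast
  have Pv: "P *v v = (c - l) *\<^sub>R v" using v(2) Nv[of v] by (simp add: algebra_simps)
  have inv_v: "matrix_inv ?N *v (?N *v w) = w" for w
    using inv by (rule matrix_inv_cancel_vec(2))
  have l0: "l \<noteq> 0" using inv_v[of v] v by auto
  have Niv: "matrix_inv ?N *v v = (1 / l) *\<^sub>R v"
  proof -
    have "l *\<^sub>R (matrix_inv ?N *v v) = v"
      using inv_v[of v] unfolding v(2) matrix_vector_mult_scaleR .
    then have "(1 / l) *\<^sub>R (l *\<^sub>R (matrix_inv ?N *v v)) = (1 / l) *\<^sub>R v" by (rule arg_cong)
    then show ?thesis using l0 by simp
  qed
  have "0 < v \<bullet> ((c *\<^sub>R mat 1 + P ** matrix_inv ?N ** P) *v v)"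
    using Z v(1) by (simp add: pos_def_def)
  also have "\<dots> = (c + (c - l)\<^sup>2 / l) * (v \<bullet> v)"
    by (simp add: matrix_vector_mult_add_rdistrib scaleR_matrix_vector_assoc[symmetric]
        matrix_vector_mul_assoc[symmetric] Pv Niv matrix_vector_mult_scaleR inner_add_right
        distrib_right power2_eq_square)
  finally have "0 < c + (c - l)\<^sup>2 / l"
    by (rule zero_less_mult_pos2) (simp add: v(1))
  have l: "0 < l"
  proof (rule ccontr)
    assume "\<not> 0 < l"
    with l0 have neg: "l < 0" by simp
    \<comment> \<open>Clearing the negative denominator reverses the inequality. The left side
      equals \<open>c * c - c * l + l * l\<close>, where \<open>- c * l\<close> is positive and the
      squares are nonnegative.\<close>
    then have "c * l + (c - l)\<^sup>2 < 0"
      using \<open>0 < c + (c - l)\<^sup>2 / l\<close> by (simp add: field_simps)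
    moreover have "c * l + (c - l)\<^sup>2 = c * c - c * l + l * l" by (simp add: power2_eq_square algebra_simps)
    moreover have "c * l < 0" using c neg by (simp add: mult_pos_neg)
    ultimately show False using c by (smt (verit) zero_le_square)
  qed
  show ?thesis
    unfolding pos_def_def
  proof (intro conjI allI impI)
    fix w :: "real^'n" assume "w \<noteq> 0"
    then have "0 < l * (norm w)\<^sup>2" using l by simp
    then show "0 < w \<bullet> (?N *v w)" using low[of w] by linarith
  qed (rule sN)
qed

text \<open>With \<open>N\<close> the gap and \<open>g v\<close> the solution of
  \<open>N *v g v = P *v v\<close>, the form of \<open>Z\<close> is
  \<open>c * (v \<bullet> v)\<close> plus the \<open>N\<close>-form of \<open>g v\<close>. The
  square of \<open>g a - b\<close> in the \<open>N\<close>-form bounds the cross term, and the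
  \<open>P\<close>-form of \<open>b\<close> then cancels. The \<open>P\<close>-form of
  \<open>a\<close> is at most \<open>c * (a \<bullet> a)\<close>, and the \<open>N\<close>-form of
  \<open>g b\<close> is nonnegative.\<close>

lemma quad_form_split:
  fixes P :: "real^'n^'n"
  assumes P: "symmetric_mat P" and N: "pos_def (c *\<^sub>R mat 1 - P)"
    and Z_eq: "Z = c *\<^sub>R mat 1 + P ** matrix_inv (c *\<^sub>R mat 1 - P) ** P"
  shows "(a + b) \<bullet> (P *v (a + b)) \<le> a \<bullet> (Z *v a) + b \<bullet> (Z *v b)"
proof -
  let ?N = "c *\<^sub>R mat 1 - P"
  have Nv: "?N *v v = c *\<^sub>R v - P *v v" for v
    by (simp add: matrix_vector_mult_diff_rdistrib scaleR_matrix_vector_assoc[symmetric])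
  define g where "g v = matrix_inv ?N *v (P *v v)" for v
  have g: "?N *v g v = P *v v" for v
    unfolding g_def using N pos_def_invertible matrix_inv_cancel_vec(1) by blast
  have Zv: "v \<bullet> (Z *v v) = c * (v \<bullet> v) + g v \<bullet> (?N *v g v)" for v
  proof -
    have "v \<bullet> (Z *v v) = c * (v \<bullet> v) + v \<bullet> (P *v g v)"
      by (simp add: Z_eq g_def matrix_vector_mult_add_rdistrib scaleR_matrix_vector_assoc[symmetric]
          matrix_vector_mul_assoc[symmetric] inner_add_right)
    moreover have "v \<bullet> (P *v g v) = g v \<bullet> (?N *v g v)"
      unfolding g using symmetric_mat_inner[OF P, of v "g v"] by (simp only: inner_commute)
    ultimately show ?thesis by simp
  qed
  have "0 \<le> (g a - b) \<bullet> (?N *v (g a - b))" by (rule pos_def_nonneg[OF N])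
  also have "\<dots> = g a \<bullet> (?N *v g a) - 2 * (b \<bullet> (P *v a)) + b \<bullet> (?N *v b)"
  proof -
    have "g a \<bullet> (?N *v b) = b \<bullet> (P *v a)"
      using symmetric_mat_inner[of ?N "g a" b] N by (simp add: pos_def_def g inner_commute)
    moreover have "b \<bullet> (?N *v g a) = b \<bullet> (P *v a)" by (simp add: g)
    ultimately show ?thesis
      by (simp add: matrix_vector_mult_diff_distrib inner_diff_left inner_diff_right)
  qed
  finally have 1: "0 \<le> g a \<bullet> (?N *v g a) - 2 * (b \<bullet> (P *v a)) + b \<bullet> (?N *v b)" .
  have 2: "0 \<le> a \<bullet> (?N *v a)" "0 \<le> g b \<bullet> (?N *v g b)"
    using N by (auto intro: pos_def_nonneg)
  have "v \<bullet> (?N *v v) = c * (v \<bullet> v) - v \<bullet> (P *v v)" for v by (simp add: Nv inner_diff_right)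
  moreover have "a \<bullet> (P *v b) = b \<bullet> (P *v a)" using symmetric_mat_inner[OF P, of a b] by (simp only: inner_commute)
  ultimately show ?thesis
    using 1 2 Zv[of a] Zv[of b]
    by (simp add: matrix_vector_right_distrib inner_add_left inner_add_right)
qed

section \<open>Riccati equation and the closed loop\<close>

lemma symmetric_mat_range_complement: "symmetric_mat (mat 1 - B ** pseudo_inverse B)"
proof -
  have "transpose (mat 1 - X) = mat 1 - X" if "transpose X = X" for X :: "real^'n^'n"
  proof -
    have "transpose (mat 1 - X) = transpose (mat 1) - transpose X"
      by (simp add: transpose_def vec_eq_iff)
    then show ?thesis using that by simp
  qed
  then show ?thesis
    using is_pseudo_inverse_pseudo_inverse[of B]
    unfolding is_pseudo_inverse_def symmetric_mat_def by blast
qed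

text \<open>Put \<open>y = matrix_inv M *v (A *v x)\<close>, so that the right side is
  \<open>y \<bullet> (M *v y)\<close>. The weighted squares of \<open>K *v x\<close> and
  \<open>L *v x\<close> are exactly the \<open>B\<close>-summand and the \<open>W\<close>-summand of
  this form, leaving the nonnegative form of \<open>matrix_inv P\<close>. Symmetry of
  \<open>W\<close> reconciles \<open>transpose W\<close> in \<open>M\<close> with \<open>W\<close>
  in \<open>L\<close>.\<close>

lemma Riccati_gain_bound:
  fixes A L M P R2 W :: "real^'n^'n" and B :: "real^'m^'n" and K :: "real^'n^'m"
  assumes R1: "pos_def R1" and R2: "pos_def R2" and P: "pos_def P" and W: "symmetric_mat W"
    and M_eq: "M = matrix_inv P + B ** matrix_inv R1 ** transpose B
        + \<alpha>\<^sup>2 *\<^sub>R (W ** matrix_inv R2 ** transpose W)"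
    and K_eq: "K = - (matrix_inv R1 ** transpose B ** matrix_inv M ** A)"
    and L_eq: "L = - (\<alpha> *\<^sub>R (matrix_inv R2 ** W ** matrix_inv M ** A))"
  shows "(K *v x) \<bullet> (R1 *v (K *v x)) + (L *v x) \<bullet> (R2 *v (L *v x))
      \<le> (A *v x) \<bullet> (matrix_inv M *v (A *v x))"
proof -
  have Wt: "transpose W = W" using W by (simp add: symmetric_mat_def)
  have Mform: "y \<bullet> (M *v y) = y \<bullet> (matrix_inv P *v y)
      + (transpose B *v y) \<bullet> (matrix_inv R1 *v (transpose B *v y))
      + \<alpha>\<^sup>2 * ((W *v y) \<bullet> (matrix_inv R2 *v (W *v y)))" for y
  proof -
    have "y \<bullet> (B *v z) = (transpose B *v y) \<bullet> z" for z
      by (metis inner_transpose_mult transpose_transpose)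
    then show ?thesis
      using symmetric_mat_inner[OF W, of y]
      by (simp add: M_eq Wt matrix_vector_mult_add_rdistrib scaleR_matrix_vector_assoc[symmetric]
          matrix_vector_mul_assoc[symmetric] inner_add_right)
  qed
  have nonneg: "0 \<le> y \<bullet> (matrix_inv R *v y)" if "pos_def R" for R :: "real^'k^'k" and y
    using pos_def_inv_pos[OF that, of y] by (cases "y = 0") auto
  \<comment> \<open>The summand \<open>matrix_inv P\<close> is strictly positive and the others are
    nonnegative, so \<open>M\<close> has trivial kernel and \<open>matrix_inv M\<close> is a true
    inverse.\<close>
  have "M *v y \<noteq> 0" if "y \<noteq> 0" for y
  proof -
    have "0 < y \<bullet> (M *v y)"
      unfolding Mform using pos_def_inv_pos[OF P that] nonneg[OF R1] nonneg[OF R2]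
      by (intro add_pos_nonneg mult_nonneg_nonneg) auto
    then show ?thesis by auto
  qed
  then have "invertible M"
    using matrix_left_invertible_ker[of M] invertible_left_inverse[of M] by blast
  define y where "y = matrix_inv M *v (A *v x)"
  have My: "M *v y = A *v x" unfolding y_def using \<open>invertible M\<close> by (rule matrix_inv_cancel_vec(1))
  have Kx: "K *v x = - (matrix_inv R1 *v (transpose B *v y))"
    by (simp add: K_eq y_def matrix_vector_mult_uminus_left matrix_vector_mul_assoc matrix_mul_assoc)
  have Lx: "L *v x = - (\<alpha> *\<^sub>R (matrix_inv R2 *v (W *v y)))"
    by (simp add: L_eq y_def matrix_vector_mult_uminus_left scaleR_matrix_vector_assoc[symmetric]
        matrix_vector_mul_assoc matrix_mul_assoc)
  have neg: "C *v (- v) = - (C *v v)" for C :: "real^'k^'l" and v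
    by (metis matrix_vector_mult_diff_distrib diff_0 matrix_vector_mult_0_right)
  have "(K *v x) \<bullet> (R1 *v (K *v x)) = (transpose B *v y) \<bullet> (matrix_inv R1 *v (transpose B *v y))"
    by (simp add: Kx neg matrix_inv_cancel_vec(1)[OF pos_def_invertible[OF R1]] inner_commute)
  moreover have "(L *v x) \<bullet> (R2 *v (L *v x)) = \<alpha>\<^sup>2 * ((W *v y) \<bullet> (matrix_inv R2 *v (W *v y)))"
    by (simp add: Lx neg matrix_vector_mult_scaleR matrix_inv_cancel_vec(1)[OF pos_def_invertible[OF R2]]
        inner_commute power2_eq_square)
  moreover have "(A *v x) \<bullet> (matrix_inv M *v (A *v x)) = y \<bullet> (M *v y)"
    by (simp add: My y_def[symmetric] inner_commute)
  ultimately show ?thesis using Mform[of y] nonneg[OF P, of y] by simp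
qed

theorem theorem2:
  fixes A Q F R2 P L Ac M Z Q1 :: "real^'n^'n"
    and B :: "real^'m^'n"
    and R1 :: "real^'m^'m"
    and K :: "real^'n^'m"
    and \<Omega> :: "'p::metric_space set"
    and \<Delta>A :: "'p \<Rightarrow> real^'n^'n"
    and \<alpha> \<beta> \<epsilon> \<sigma> \<mu>1 :: real
  assumes bounded_params: "bounded \<Omega>"
    and Q: "pos_semidef Q"
    and R1: "pos_def R1"
    and R2: "pos_def R2"
    and F: "symmetric_mat F"
    and eps: "0 < \<epsilon>"
    and P: "pos_def P"
    and M_eq: "M = matrix_inv P + B ** matrix_inv R1 ** transpose B
        + \<alpha>\<^sup>2 *\<^sub>R ((mat 1 - B ** pseudo_inverse B) ** matrix_inv R2
                ** transpose (mat 1 - B ** pseudo_inverse B))"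
    and Riccati: "transpose A ** matrix_inv M ** A - P + Q + F + \<beta>\<^sup>2 *\<^sub>R mat 1 = 0"
    and K_eq: "K = - (matrix_inv R1 ** transpose B ** matrix_inv M ** A)"
    and L_eq: "L = - (\<alpha> *\<^sub>R (matrix_inv R2 ** (mat 1 - B ** pseudo_inverse B)
                          ** matrix_inv M ** A))"
    and Ac_eq: "Ac = A + B ** K"
    and inv: "invertible (inverse \<epsilon> *\<^sub>R mat 1 - P)"
    and Z_eq: "Z = inverse \<epsilon> *\<^sub>R mat 1 + P ** matrix_inv (inverse \<epsilon> *\<^sub>R mat 1 - P) ** P"
    and Z: "pos_def Z"
    and uncertainty: "\<And>p. p \<in> \<Omega> \<Longrightarrow> transpose (\<Delta>A p) ** Z ** \<Delta>A p \<preceq>\<^sub>L F"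
    and Q1_eq: "Q1 = \<beta>\<^sup>2 *\<^sub>R mat 1 + transpose K ** R1 ** K + transpose L ** R2 ** L
                  - transpose Ac ** Z ** Ac"
    and Q1_nonneg: "pos_semidef Q1"
    and Q1: "pos_def Q1"
    and sigma: "0 < \<sigma>" "\<sigma> < 1"
    and nonzero: "transpose K ** transpose B ** Z ** B ** K \<noteq> 0"
    and mu1_eq: "\<mu>1 = \<sigma> * lambda_min Q1 / mat_norm (transpose K ** transpose B ** Z ** B ** K)"
  shows "\<forall>p\<in>\<Omega>. input_to_state_stable (event_triggered_system (A + \<Delta>A p) B K \<mu>1)"
proof
  fix p assume p: "p \<in> \<Omega>"
  have cong: "x \<bullet> ((transpose C ** D ** C) *v x) = (C *v x) \<bullet> (D *v (C *v x))"
    for C :: "real^'n^'k" and D x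
    by (simp add: matrix_vector_mul_assoc[symmetric] inner_transpose_mult del: transpose_matrix_vector)
  have N: "pos_def (inverse \<epsilon> *\<^sub>R mat 1 - P)"
    using pos_def_gap_of_pos_def_Z[OF P _ inv] Z eps unfolding Z_eq by simp
  \<comment> \<open>When the estimates below are added, the \<open>Z\<close>-form of
    \<open>Ac *v x\<close> is replaced through \<open>Q1\<close>, the gain terms are absorbed by the
    form of \<open>matrix_inv M\<close>, and the Riccati equation cancels the \<open>F\<close> and
    \<open>\<beta>\<close> terms. What remains beyond the claim is the nonpositive
    \<open>- x \<bullet> (Q *v x)\<close>.\<close>
  have decrease: "((A + \<Delta>A p + B ** K) *v x) \<bullet> (P *v ((A + \<Delta>A p + B ** K) *v x))
      \<le> x \<bullet> (P *v x) - x \<bullet> (Q1 *v x)" for x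
  proof -
    have "(A + \<Delta>A p + B ** K) *v x = Ac *v x + \<Delta>A p *v x"
      by (simp add: Ac_eq matrix_vector_mult_add_rdistrib)
    then have "((A + \<Delta>A p + B ** K) *v x) \<bullet> (P *v ((A + \<Delta>A p + B ** K) *v x))
        \<le> (Ac *v x) \<bullet> (Z *v (Ac *v x)) + (\<Delta>A p *v x) \<bullet> (Z *v (\<Delta>A p *v x))"
      using quad_form_split[OF _ N Z_eq] P by (simp add: pos_def_def)
    moreover have "(\<Delta>A p *v x) \<bullet> (Z *v (\<Delta>A p *v x)) \<le> x \<bullet> (F *v x)"
    proof -
      have "0 \<le> x \<bullet> ((F - transpose (\<Delta>A p) ** Z ** \<Delta>A p) *v x)"
        using uncertainty[OF p] unfolding loewner_le_def pos_semidef_def by blast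
      then show ?thesis by (simp add: matrix_vector_mult_diff_rdistrib inner_diff_right cong)
    qed
    moreover have "x \<bullet> (Q1 *v x) = \<beta>\<^sup>2 * (x \<bullet> x) + (K *v x) \<bullet> (R1 *v (K *v x))
        + (L *v x) \<bullet> (R2 *v (L *v x)) - (Ac *v x) \<bullet> (Z *v (Ac *v x))"
      by (simp add: Q1_eq matrix_vector_mult_add_rdistrib matrix_vector_mult_diff_rdistrib
          inner_add_right inner_diff_right cong scaleR_matrix_vector_assoc[symmetric])
    moreover have "(K *v x) \<bullet> (R1 *v (K *v x)) + (L *v x) \<bullet> (R2 *v (L *v x))
        \<le> (A *v x) \<bullet> (matrix_inv M *v (A *v x))"
      by (rule Riccati_gain_bound[OF R1 R2 P symmetric_mat_range_complement M_eq K_eq L_eq])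
    moreover have "(A *v x) \<bullet> (matrix_inv M *v (A *v x)) - x \<bullet> (P *v x) + x \<bullet> (Q *v x)
        + x \<bullet> (F *v x) + \<beta>\<^sup>2 * (x \<bullet> x) = 0"
    proof -
      have "x \<bullet> ((transpose A ** matrix_inv M ** A - P + Q + F + \<beta>\<^sup>2 *\<^sub>R mat 1) *v x) = 0"
        by (simp only: Riccati matrix_vector_mult_0 inner_zero_right)
      then show ?thesis
        by (simp add: matrix_vector_mult_add_rdistrib matrix_vector_mult_diff_rdistrib
            inner_add_right inner_diff_right cong scaleR_matrix_vector_assoc[symmetric])
    qed
    moreover have "0 \<le> x \<bullet> (Q *v x)" using Q by (simp add: pos_semidef_def)
    ultimately show ?thesis by linarith
  qed
  show "input_to_state_stable (event_triggered_system (A + \<Delta>A p) B K \<mu>1)"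
    \<comment> \<open>The form of \<open>P\<close> is the Lyapunov function, and the error enters
      through \<open>H = B ** K\<close>.\<close>
    by (rule Lyapunov_imp_input_to_state_stable[OF P Q1 decrease])
      (auto simp: event_triggered_system_def dest: event_triggered_run_error_form)
qed

end
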